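(* Let $X\neq\{0\}$ be a real Hilbert space, let $m\in\{2,3,\ldots\}$, let $R\colon X\to X$ be a linear isometry with $R^m=\operatorname{Id}$, let $M:=\operatorname{Id}-R$, let $D:=\ker M=\{x\in X: Rx=x\}$, and let $$T:=\frac{1}{2m}\sum_{k=1}^{m-1}(m-2k)R^k.$$ Then the Moore-Penrose inverse of $M$ is $$M^\dagger=\tfrac12P_{D^\perp}(\operatorname{Id}+2T)=\sum_{k=0}^{m-1}\frac{m-1-2k}{2m}R^k.$$
   Context: $\operatorname{Id}$ is the identity operator on $X$, and $P_{D^\perp}$ is the orthogonal projector onto the orthogonal complement $D^\perp$ of $D$. The Moore-Penrose inverse $M^\dagger$ of $M$ is defined as follows: for $y\in X$, $M^\dagger y$ is the (unique) minimum norm vector among all solutions $x\in X$ of the least squares problem $\|Mx-y\|=\min_{z\in X}\|Mz-y\|$ (well defined on all of $X$ because $\operatorname{ran}M$ is closed). *)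

theory Defs
  imports "HOL-Analysis.Analysis"
begin

text \<open>A real Hilbert space is a type of class \<^class>\<open>real_inner\<close> and \<^class>\<open>complete_space\<close>;
  linear operators on it are plain functions, composed pointwise and iterated with \<open>^^\<close>.\<close>

definition linear_isometry :: "('a::real_inner \<Rightarrow> 'a) \<Rightarrow> bool" where
  "linear_isometry R \<longleftrightarrow> linear R \<and> (\<forall>x. norm (R x) = norm x)"

text \<open>The definite descriptions below are meaningful only where the described vector exists, as it
  does when \<open>S\<close> is a closed subspace, respectively when \<open>M\<close> is bounded linear with closed range,
  of a Hilbert space. The two rules show that it is unique.\<close>

definition orthogonal_projector :: "'a::real_inner set \<Rightarrow> 'a \<Rightarrow> 'a" where
  "orthogonal_projector S x = (THE p. p \<in> S \<and> x - p \<in> S\<^sup>\<bottom>)"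

definition least_squares_solutions :: "('a::real_inner \<Rightarrow> 'a) \<Rightarrow> 'a \<Rightarrow> 'a set" where
  "least_squares_solutions M y = {x. \<forall>z. norm (M x - y) \<le> norm (M z - y)}"

definition moore_penrose :: "('a::real_inner \<Rightarrow> 'a) \<Rightarrow> 'a \<Rightarrow> 'a" where
  "moore_penrose M y = (THE x. x \<in> least_squares_solutions M y \<and>
     (\<forall>x' \<in> least_squares_solutions M y. norm x \<le> norm x'))"

lemma orthogonal_projector_eqI:
  assumes "subspace S" "p \<in> S" "x - p \<in> S\<^sup>\<bottom>"
  shows "orthogonal_projector S x = p"
  unfolding orthogonal_projector_def
proof (rule the_equality)
  fix q assume q: "q \<in> S \<and> x - q \<in> S\<^sup>\<bottom>"
  have "(x - q) - (x - p) \<in> S\<^sup>\<bottom>"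
    using q assms(3) by (blast intro: subspace_diff subspace_orthogonal_comp)
  moreover have "p - q \<in> S" using q assms by (intro subspace_diff) auto
  ultimately have "(p - q) \<bullet> (p - q) = 0"
    by (simp add: orthogonal_comp_def orthogonal_def)
  then show "q = p" by simp
qed (use assms in auto)

lemma moore_penrose_eqI:
  assumes M: "linear M" and x: "x \<in> least_squares_solutions M y"
    and min: "\<And>x'. x' \<in> least_squares_solutions M y \<Longrightarrow> norm x \<le> norm x'"
  shows "moore_penrose M y = x"
  unfolding moore_penrose_def
proof (rule the_equality)
  fix u assume u: "u \<in> least_squares_solutions M y \<and>
    (\<forall>x' \<in> least_squares_solutions M y. norm u \<le> norm x')"
  define w where "w = (1/2) *\<^sub>R (u + x)"
  have "M w - y = (1/2) *\<^sub>R ((M u - y) + (M x - y))"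
    by (simp add: w_def linear_scale[OF M] linear_add[OF M] algebra_simps flip: scaleR_add_left)
  then have "norm (M w - y) = norm ((M u - y) + (M x - y)) / 2" by simp
  also have "\<dots> \<le> (norm (M u - y) + norm (M x - y)) / 2"
    using norm_triangle_ineq[of "M u - y" "M x - y"] by simp
  finally have le: "norm (M w - y) \<le> (norm (M u - y) + norm (M x - y)) / 2" .
  have "w \<in> least_squares_solutions M y"
    unfolding least_squares_solutions_def mem_Collect_eq
  proof
    fix z
    have "norm (M u - y) \<le> norm (M z - y)" "norm (M x - y) \<le> norm (M z - y)"
      using u x by (auto simp: least_squares_solutions_def)
    then have "(norm (M u - y) + norm (M x - y)) / 2 \<le> norm (M z - y)" by simp
    with le show "norm (M w - y) \<le> norm (M z - y)" by (rule order_trans)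
  qed
  then have "norm x \<le> norm w" by (rule min)
  moreover have eq: "norm u = norm x" using u x min by (meson order_antisym)
  ultimately have "2 * norm x \<le> norm (u + x)" by (simp add: w_def)
  then have "(2 * norm x)\<^sup>2 \<le> (norm (u + x))\<^sup>2" by (intro power_mono) auto
  then have "4 * (norm x)\<^sup>2 \<le> (norm (u + x))\<^sup>2" by (simp add: power_mult_distrib)
  moreover have "(norm (u + x))\<^sup>2 + (norm (u - x))\<^sup>2 = 2 * (norm u)\<^sup>2 + 2 * (norm x)\<^sup>2"
    by (simp add: power2_norm_eq_inner algebra_simps inner_commute)
  ultimately have "(norm (u - x))\<^sup>2 \<le> 0" unfolding eq by linarith
  then show "u = x" by simp
qed (use x min in auto)

end

theory Submission
  imports Defs
begin

text \<open>
  Let \<open>A x = (1/m) \<Sum>k<m. R\<^sup>k x\<close> be the mean over the cyclic group generated by \<open>R\<close> and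
  \<open>B x = \<Sum>k<m. c\<^sub>k R\<^sup>k x\<close> with \<open>c\<^sub>k = (m - 1 - 2 k) / (2 m)\<close>, the claimed inverse. Three facts
  carry the proof.

  \<^item> The values of \<open>A\<close> are fixed by \<open>R\<close>, since \<open>R\<close> permutes the orbit cyclically
    (\<open>orbit_sum_fixed\<close>).
  \<^item> The coefficients fall by \<open>1/m\<close> at each step and by \<open>1\<close> over a full period, so that
    \<open>B - R B\<close> telescopes to \<open>Id - A\<close> (\<open>affine_orbit_sum_diff\<close>).
  \<^item> The coefficients sum to zero, and all \<open>R\<^sup>k x\<close> have the same inner product with a fixed point of
    \<open>R\<close>; hence \<open>B\<close> takes values in \<open>D\<^sup>\<bottom>\<close> (\<open>inner_funpow_fixed\<close>, \<open>sum_coeffs_zero\<close>).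

  As \<open>R\<close> preserves inner products, the range of \<open>M = Id - R\<close> is orthogonal to \<open>D\<close>. So the residual
  \<open>M (B y) - y = - A y\<close> is orthogonal to the range of \<open>M\<close>, which makes \<open>B y\<close> a least squares
  solution, and \<open>B y\<close> is orthogonal to the kernel of \<open>M\<close>, which makes it the shortest one
  (\<open>moore_penrose_eqI_orthogonal\<close>). Finally \<open>Id + 2 T = 2 B + A\<close>, where \<open>2 B\<close> takes values in
  \<open>D\<^sup>\<bottom>\<close> and \<open>A\<close> in \<open>D\<close>; projecting onto \<open>D\<^sup>\<bottom>\<close> therefore leaves \<open>2 B\<close>.
\<close>

text \<open>Both minimisations follow from Pythagoras: \<open>residual\<close> is the normal equation of the
  least squares problem, and every other solution differs from \<open>x\<close> by an element of the kernel.\<close>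

lemma moore_penrose_eqI_orthogonal:
  assumes M: "linear M"
    and residual: "\<And>z. M z \<bullet> (M x - y) = 0"
    and kernel: "\<And>z. M z = 0 \<Longrightarrow> z \<bullet> x = 0"
  shows "moore_penrose M y = x"
proof (rule moore_penrose_eqI[OF M])
  have pyth: "(norm (M z - y))\<^sup>2 = (norm (M (z - x)))\<^sup>2 + (norm (M x - y))\<^sup>2" for z
  proof -
    have "M z - y = M (z - x) + (M x - y)" by (simp add: linear_diff[OF M])
    moreover have "orthogonal (M (z - x)) (M x - y)" by (simp add: orthogonal_def residual)
    ultimately show ?thesis by (simp only: norm_add_Pythagorean)
  qed
  show "x \<in> least_squares_solutions M y"
    unfolding least_squares_solutions_def mem_Collect_eq
  proof
    fix z
    show "norm (M x - y) \<le> norm (M z - y)"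
      by (rule power2_le_imp_le) (simp_all add: pyth[of z])
  qed
  fix x' assume "x' \<in> least_squares_solutions M y"
  then have "norm (M x' - y) \<le> norm (M x - y)" by (simp add: least_squares_solutions_def)
  then have "(norm (M x' - y))\<^sup>2 \<le> (norm (M x - y))\<^sup>2" by (simp add: power_mono)
  then have "M (x' - x) = 0" by (simp add: pyth[of x'])
  then have "orthogonal (x' - x) x" using kernel by (simp add: orthogonal_def)
  from norm_add_Pythagorean[OF this] have "(norm x)\<^sup>2 \<le> (norm x')\<^sup>2" by simp
  then show "norm x \<le> norm x'" by (rule power2_le_imp_le) simp
qed

lemma linear_isometry_inner:
  assumes "linear_isometry R"
  shows "R x \<bullet> R y = x \<bullet> y"
  using assms orthogonal_transformation[of R]
  by (simp add: linear_isometry_def orthogonal_transformation_def)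

lemma inner_funpow_fixed:
  assumes "linear_isometry R" "R d = d"
  shows "d \<bullet> (R ^^ k) x = d \<bullet> x"
proof (induction k)
  case (Suc k)
  then show ?case using linear_isometry_inner[OF assms(1), of d "(R ^^ k) x"] assms(2) by simp
qed simp

lemma inner_diff_fixed:
  assumes "linear_isometry R" "R d = d"
  shows "(z - R z) \<bullet> d = 0"
  using inner_funpow_fixed[OF assms, of 1 z] by (simp add: inner_commute inner_diff_right)

lemma orbit_sum_fixed:
  fixes R :: "'a::real_vector \<Rightarrow> 'a"
  assumes "linear R" "R ^^ m = id"
  shows "R (\<Sum>k<m. (R ^^ k) x) = (\<Sum>k<m. (R ^^ k) x)"
proof -
  have "x + (\<Sum>k<m. (R ^^ Suc k) x) = (\<Sum>k<m. (R ^^ k) x) + (R ^^ m) x"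
    using sum.lessThan_Suc_shift[of "\<lambda>k. (R ^^ k) x" m]
    by (simp only: sum.lessThan_Suc funpow_0)
  then show ?thesis using assms(2) by (simp add: linear_sum[OF assms(1)] add.commute)
qed

text \<open>Discrete summation by parts: the shift by one step costs the constant difference \<open>\<delta>\<close> in every
  term, and the boundary terms at \<open>0\<close> and \<open>m\<close> meet at the same point \<open>x\<close> by periodicity.\<close>

lemma affine_orbit_sum_diff:
  fixes R :: "'a::real_vector \<Rightarrow> 'a" and c :: "nat \<Rightarrow> real" and x :: 'a
  assumes R: "linear R" "R ^^ m = id"
    and step: "\<And>k. c k = c (Suc k) + \<delta>"
  defines "S \<equiv> \<Sum>k<m. c k *\<^sub>R (R ^^ k) x"
  shows "S - R S = (c 0 - c m) *\<^sub>R x - \<delta> *\<^sub>R (\<Sum>k<m. (R ^^ k) x)"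
proof -
  have "c 0 *\<^sub>R x + (\<Sum>k<m. c (Suc k) *\<^sub>R (R ^^ Suc k) x) = S + c m *\<^sub>R x"
    using sum.lessThan_Suc_shift[of "\<lambda>k. c k *\<^sub>R (R ^^ k) x" m] R(2)
    by (simp only: S_def sum.lessThan_Suc funpow_0 id_apply)
  then have shift: "(\<Sum>k<m. c (Suc k) *\<^sub>R (R ^^ Suc k) x) = S + c m *\<^sub>R x - c 0 *\<^sub>R x"
    by (simp add: algebra_simps)
  have "R S = (\<Sum>k<m. c k *\<^sub>R (R ^^ Suc k) x)"
    by (simp add: S_def linear_sum[OF R(1)] linear_scale[OF R(1)])
  also have "\<dots> = (\<Sum>k<m. c (Suc k) *\<^sub>R (R ^^ Suc k) x + \<delta> *\<^sub>R (R ^^ Suc k) x)"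
    by (simp only: step[symmetric] flip: scaleR_add_left)
  also have "\<dots> = (\<Sum>k<m. c (Suc k) *\<^sub>R (R ^^ Suc k) x) + \<delta> *\<^sub>R R (\<Sum>k<m. (R ^^ k) x)"
    by (simp add: sum.distrib scaleR_sum_right linear_sum[OF R(1)])
  also have "R (\<Sum>k<m. (R ^^ k) x) = (\<Sum>k<m. (R ^^ k) x)"
    by (rule orbit_sum_fixed[OF R])
  finally show ?thesis by (simp only: shift) (simp add: algebra_simps)
qed

lemma sum_coeffs_zero: "(\<Sum>k<m. (real m - 1 - 2 * real k) / (2 * real m)) = 0"
proof -
  have "(\<Sum>k<n. a - 2 * real k) = real n * (a - real n + 1)" for n a
    by (induction n) (simp_all add: algebra_simps)
  from this[of "real m - 1" m] show ?thesis by (simp flip: sum_divide_distrib)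
qed

theorem theorem3p5:
  fixes R M T :: "'a::{real_inner,complete_space} \<Rightarrow> 'a"
    and D :: "'a set" and m :: nat
  assumes "(UNIV :: 'a set) \<noteq> {0}"
    and "m \<ge> 2"
    and "linear_isometry R"
    and "R ^^ m = id"
    and "M = (\<lambda>x. x - R x)"
    and "D = {x. M x = 0}"
    and "T = (\<lambda>x. (1 / (2 * real m)) *\<^sub>R
               (\<Sum>k=1..m - 1. (real m - 2 * real k) *\<^sub>R (R ^^ k) x))"
  shows "moore_penrose M =
           (\<lambda>x. (1 / 2) *\<^sub>R orthogonal_projector (D\<^sup>\<bottom>) (x + 2 *\<^sub>R T x)) \<and>
         (\<lambda>x. (1 / 2) *\<^sub>R orthogonal_projector (D\<^sup>\<bottom>) (x + 2 *\<^sub>R T x)) =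
           (\<lambda>x. \<Sum>k=0..m - 1. ((real m - 1 - 2 * real k) / (2 * real m)) *\<^sub>R (R ^^ k) x)"
proof -
  define c where "c k = (real m - 1 - 2 * real k) / (2 * real m)" for k
  define A where "A x = (1 / real m) *\<^sub>R (\<Sum>k<m. (R ^^ k) x)" for x
  define B where "B x = (\<Sum>k<m. c k *\<^sub>R (R ^^ k) x)" for x
  have m: "m > 0" using assms(2) by simp
  have R: "linear R" using assms(3) by (simp add: linear_isometry_def)
  have M: "linear M" unfolding assms(5) by (intro linear_compose_sub linear_id[unfolded id_def] R)
  have D: "d \<in> D \<longleftrightarrow> R d = d" for d using assms(5,6) by auto
  have D_perp: "subspace (D\<^sup>\<bottom>)" by (rule subspace_orthogonal_comp)

  have A_D: "A x \<in> D" for x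
    unfolding D A_def by (simp add: linear_scale[OF R] orbit_sum_fixed[OF R assms(4)])
  have B_perp: "d \<bullet> B x = 0" if "d \<in> D" for d x
  proof -
    have "d \<bullet> B x = (\<Sum>k<m. c k) * (d \<bullet> x)"
      using that inner_funpow_fixed[OF assms(3)]
      by (simp add: B_def D inner_sum_right sum_distrib_right)
    then show ?thesis by (simp add: c_def sum_coeffs_zero)
  qed
  have MB: "M (B x) = x - A x" for x
  proof -
    have step: "c k = c (Suc k) + 1 / real m" for k
      using m by (simp add: c_def field_simps)
    have drop: "c 0 - c m = 1"
      using m by (simp add: c_def field_simps)
    show ?thesis
      using affine_orbit_sum_diff[where c = c, OF R assms(4) step, of x]
      by (simp add: assms(5) A_def B_def drop)
  qed

  have MP: "moore_penrose M y = B y" for y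
  proof (rule moore_penrose_eqI_orthogonal[OF M])
    show "M z \<bullet> (M (B y) - y) = 0" for z
      using inner_diff_fixed[OF assms(3), of "A y" z] A_D[of y]
      by (simp add: MB D) (simp add: assms(5))
    show "z \<bullet> B y = 0" if "M z = 0" for z
      using that B_perp by (simp add: assms(6))
  qed

  have T: "x + 2 *\<^sub>R T x = 2 *\<^sub>R B x + A x" for x
  proof -
    \<comment> \<open>The identity is the missing term \<open>k = 0\<close> of \<open>2 T\<close>, whose coefficient is \<open>m / m\<close>.\<close>
    have "x + 2 *\<^sub>R T x = (\<Sum>k<m. ((real m - 2 * real k) / real m) *\<^sub>R (R ^^ k) x)"
    proof -
      have "2 *\<^sub>R T x = (\<Sum>k=1..m - 1. ((real m - 2 * real k) / real m) *\<^sub>R (R ^^ k) x)"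
        unfolding assms(7) scaleR_sum_right scaleR_scaleR
        using m by (intro sum.cong refl arg_cong2[where f = scaleR]) (simp add: field_simps)
      moreover have "{..<m} = insert 0 {1..m - 1}" using m by auto
      ultimately show ?thesis using m by simp
    qed
    also have "\<dots> = (\<Sum>k<m. 2 *\<^sub>R (c k *\<^sub>R (R ^^ k) x) + (1 / real m) *\<^sub>R (R ^^ k) x)"
      using m by (intro sum.cong refl)
        (simp add: c_def field_simps flip: scaleR_add_left)
    also have "\<dots> = 2 *\<^sub>R B x + A x"
      by (simp add: A_def B_def sum.distrib scaleR_sum_right)
    finally show ?thesis .
  qed
  have proj: "orthogonal_projector (D\<^sup>\<bottom>) (x + 2 *\<^sub>R T x) = 2 *\<^sub>R B x" for x
  proof (rule orthogonal_projector_eqI[OF D_perp])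
    show "2 *\<^sub>R B x \<in> D\<^sup>\<bottom>"
      using B_perp by (simp add: orthogonal_comp_def orthogonal_def)
    show "x + 2 *\<^sub>R T x - 2 *\<^sub>R B x \<in> D\<^sup>\<bottom>\<^sup>\<bottom>"
      using A_D[of x] by (auto simp: T orthogonal_comp_def orthogonal_def inner_commute)
  qed

  have "{0..m - 1} = {..<m}" using m by auto
  then show ?thesis by (simp add: fun_eq_iff MP proj B_def c_def)
qed

end
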